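(* Let $\mathcal H$ be a real Hilbert space, let $f\in\Gamma_0(\mathcal H)$ and $\gamma\in\,]0,+\infty[$ be such that the Moreau envelope ${}^{\gamma}f$ satisfies $\{x\in\mathcal H:{}^{\gamma}f(x)\leq 0\}\neq\varnothing$. Then $\operatorname{dom}G_{{}^{\gamma}f}=\mathcal H$, $G_{{}^{\gamma}f}$ is single-valued, and for every $x\in\mathcal H$ $$G_{{}^{\gamma}f}x=\begin{cases}x&\text{if }{}^{\gamma}f(x)\leq 0,\\ x-\gamma\,\dfrac{{}^{\gamma}f(x)}{\|x-\operatorname{prox}_{\gamma f}x\|^2}\,(x-\operatorname{prox}_{\gamma f}x)&\text{if }{}^{\gamma}f(x)>0.\end{cases}$$
   Context: $\Gamma_0(\mathcal H)$ is the set of proper convex lower semicontinuous functions $\mathcal H\to]-\infty,+\infty]$. The Moreau envelope is ${}^{\gamma}f(x)=\inf_{y\in\mathcal H}\big(f(y)+\frac{1}{2\gamma}\|x-y\|^2\big)$, and $\operatorname{prox}_{\gamma f}x$ is the unique minimizer of $y\mapsto \gamma f(y)+\frac12\|x-y\|^2$. $\partial f$ is the convex subdifferential. For $g\in\Gamma_0(\mathcal H)$ with $\{g\leq 0\}\neq\varnothing$, the subgradient projector $G_g:\mathcal H\to 2^{\mathcal H}$ is $G_gx=\{x\}$ if $g(x)\leq 0$ and $G_gx=\{x-\frac{g(x)}{\|u\|^2}u : u\in\partial g(x)\}$ if $g(x)>0$ (subgradients at points where $g>0$ are nonzero because $\{g\leq0\}\neq\varnothing$); $\operatorname{dom}G_g=\{x:G_gx\neq\varnothing\}$,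 and singletons are identified with their element. *)

theory Defs
  imports "HOL-Analysis.Analysis"
begin

definition lower_semicontinuous :: "('a::topological_space \<Rightarrow> ereal) \<Rightarrow> bool" where
  "lower_semicontinuous f \<longleftrightarrow> (\<forall>x. f x \<le> Liminf (at x) f)"

definition proper_function :: "('a \<Rightarrow> ereal) \<Rightarrow> bool" where
  "proper_function f \<longleftrightarrow> (\<forall>x. f x \<noteq> -\<infinity>) \<and> (\<exists>x. f x \<noteq> \<infinity>)"

text \<open>Meant for functions that never take the value \<open>-\<infinity>\<close>, so that the sum on the right
  is never of the form \<open>\<infinity> + (-\<infinity>)\<close>.\<close>

definition convex_function :: "('a::real_vector \<Rightarrow> ereal) \<Rightarrow> bool" where
  "convex_function f \<longleftrightarrow>
     (\<forall>x y t. 0 < t \<and> t < 1 \<longrightarrow>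
        f ((1 - t) *\<^sub>R x + t *\<^sub>R y) \<le> ereal (1 - t) * f x + ereal t * f y)"

definition Gamma0 :: "('a::real_inner \<Rightarrow> ereal) set" where
  "Gamma0 = {f. proper_function f \<and> convex_function f \<and> lower_semicontinuous f}"

definition moreau_envelope :: "real \<Rightarrow> ('a::real_inner \<Rightarrow> ereal) \<Rightarrow> 'a \<Rightarrow> ereal" where
  "moreau_envelope \<gamma> f x = (INF y. f y + ereal (1 / (2 * \<gamma>) * (norm (x - y))\<^sup>2))"

text \<open>The minimizer exists and is unique when \<open>h\<close> is in \<open>Gamma0\<close> and the space is complete.
  The operator \<open>prox\<^bsub>\<gamma>f\<^esub>\<close> is \<open>prox (\<lambda>y. ereal \<gamma> * f y)\<close>.\<close>

definition prox :: "('a::real_inner \<Rightarrow> ereal) \<Rightarrow> 'a \<Rightarrow> 'a" where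
  "prox h x = (THE p. is_arg_min (\<lambda>y. h y + ereal (1 / 2 * (norm (x - y))\<^sup>2)) (\<lambda>y. True) p)"

definition subdifferential :: "('a::real_inner \<Rightarrow> ereal) \<Rightarrow> 'a \<Rightarrow> 'a set" where
  "subdifferential g x = {u. \<forall>y. ereal ((y - x) \<bullet> u) + g x \<le> g y}"

text \<open>For proper \<open>g\<close> the subdifferential is empty wherever \<open>g x = \<infinity>\<close>, so the conversion
  \<open>real_of_ereal (g x)\<close> is only ever applied to a finite value. Likewise \<open>u \<noteq> 0\<close> holds
  in the second branch as soon as \<open>g\<close> has a point with value at most \<open>0\<close>.\<close>

definition subgradient_projector :: "('a::real_inner \<Rightarrow> ereal) \<Rightarrow> 'a \<Rightarrow> 'a set" where
  "subgradient_projector g x =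
     (if g x \<le> 0 then {x}
      else {x - (real_of_ereal (g x) / (norm u)\<^sup>2) *\<^sub>R u | u. u \<in> subdifferential g x})"

definition set_valued_dom :: "('a \<Rightarrow> 'b set) \<Rightarrow> 'a set" where
  "set_valued_dom A = {x. A x \<noteq> {}}"

end

theory Submission
  imports Defs
begin

text \<open>For \<open>f \<in> Gamma0\<close> the point \<open>p = prox\<^bsub>\<gamma>f\<^esub> x\<close> is characterised by \<open>(x - p) / \<gamma>\<close> being a
  subgradient of \<open>f\<close> at \<open>p\<close>. Completing a square turns this into the statement that
  \<open>(x - p) / \<gamma>\<close> is a subgradient of the Moreau envelope at \<open>x\<close>. Conversely, the envelope lies below the
  parabola \<open>y \<mapsto> f p + \<parallel>y - p\<parallel>\<^sup>2 / (2\<gamma>)\<close> and touches it at \<open>x\<close>, so any subgradient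
  at \<open>x\<close> is the gradient of that parabola. Thus the subdifferential of the envelope is
  \<open>{(x - p) / \<gamma>}\<close> at every point.\<close>

section \<open>Consequences of membership in \<open>Gamma0\<close>\<close>

text \<open>\<open>Liminf (at x) f\<close> ignores the point \<open>x\<close> itself; the assumption
  \<open>c < f x\<close> fills that hole.\<close>

lemma lower_semicontinuous_eventually_nhds:
  assumes "lower_semicontinuous f" "c < f x"
  shows "\<forall>\<^sub>F y in nhds x. c < f y"
proof -
  have "c < Liminf (at x) f"
    using assms by (auto simp: lower_semicontinuous_def intro: less_le_trans)
  then have "\<forall>\<^sub>F y in at x. c < f y"
    by (rule less_LiminfD)
  then show ?thesis
    using assms(2) by (auto simp: eventually_at_filter elim: eventually_mono)
qed

lemma convex_functionD_ereal:
  assumes "convex_function f" "f x = ereal a" "f y = ereal b" "0 < t" "t < 1"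
  shows "f ((1 - t) *\<^sub>R x + t *\<^sub>R y) \<le> ereal ((1 - t) * a + t * b)"
proof -
  have "f ((1 - t) *\<^sub>R x + t *\<^sub>R y) \<le> ereal (1 - t) * f x + ereal t * f y"
    using assms(1,4,5) unfolding convex_function_def by blast
  then show ?thesis
    by (simp add: assms(2,3))
qed

lemma Gamma0_obtain_finite:
  assumes "f \<in> Gamma0"
  obtains x a where "f x = ereal a"
proof -
  obtain x where "f x \<noteq> \<infinity>" "f x \<noteq> -\<infinity>"
    using assms by (auto simp: Gamma0_def proper_function_def)
  then show thesis
    using that by (cases "f x") auto
qed

text \<open>Semicontinuity at one point of finiteness bounds \<open>f\<close> from below on a ball, and convexity
  propagates this along rays; no separation theorem is needed.\<close>

lemma Gamma0_linear_growth_minorant: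
  assumes f: "f \<in> Gamma0"
  shows "\<exists>x0 a b. b \<ge> 0 \<and> (\<forall>y. ereal (a - b * norm (y - x0)) \<le> f y)"
proof -
  obtain x0 a where a: "f x0 = ereal a"
    using Gamma0_obtain_finite[OF f] .
  have conv: "convex_function f" and lsc: "lower_semicontinuous f" and ninf: "\<And>y. f y \<noteq> -\<infinity>"
    using f by (auto simp: Gamma0_def proper_function_def)
  have "ereal (a - 1) < f x0"
    by (simp add: a)
  from lower_semicontinuous_eventually_nhds[OF lsc this]
  obtain d where d: "d > 0" "\<And>y. dist y x0 < d \<Longrightarrow> ereal (a - 1) < f y"
    unfolding eventually_nhds_metric by blast
  \<comment> \<open>Halving lets the bound hold on the closed ball of radius \<delta>, so points at
    distance exactly \<delta> may be tested.\<close>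
  define \<delta> where "\<delta> = d / 2"
  have \<delta>: "\<delta> > 0" "\<delta> < d"
    using d(1) by (auto simp: \<delta>_def)
  have "ereal ((a - 1) - (1 / \<delta>) * norm (y - x0)) \<le> f y" for y
  proof (cases "norm (y - x0) \<le> \<delta>")
    case True
    then have "ereal (a - 1) < f y"
      using d(2)[of y] \<delta> by (simp add: dist_norm)
    moreover have "(a - 1) - (1 / \<delta>) * norm (y - x0) \<le> a - 1"
      using \<delta> by simp
    ultimately show ?thesis
      by (meson ereal_less_eq(3) less_imp_le order_trans)
  next
    case False
    \<comment> \<open>With this weight the point \<open>z\<close> below is where the segment from
      \<open>x0\<close> to \<open>y\<close> crosses the sphere of radius \<delta>.\<close>
    define t where "t = \<delta> / norm (y - x0)"
    have n: "norm (y - x0) > \<delta>"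
      using False by simp
    have t: "0 < t" "t < 1"
      using less_trans[OF \<delta>(1) n] n \<delta>(1) by (auto simp: t_def)
    show ?thesis
    proof (cases "f y")
      case (real b)
      define z where "z = (1 - t) *\<^sub>R x0 + t *\<^sub>R y"
      have "z - x0 = t *\<^sub>R (y - x0)"
        by (simp add: z_def algebra_simps)
      then have "dist z x0 = \<delta>"
        using \<delta>(1) n by (cases "y = x0") (simp_all add: dist_norm t_def)
      then have "ereal (a - 1) < f z"
        using d(2) \<delta> by simp
      also have "f z \<le> ereal ((1 - t) * a + t * b)"
        unfolding z_def by (rule convex_functionD_ereal[OF conv a real t])
      finally have "t * (a - b) < 1"
        by (simp add: algebra_simps)
      then have "a - b < 1 / t"
        using t by (simp add: field_simps)
      then show ?thesis
        by (simp add: real t_def)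
    qed (use ninf in auto)
  qed
  moreover have "1 / \<delta> \<ge> 0"
    using \<delta> by simp
  ultimately show ?thesis
    by blast
qed

section \<open>Existence of a minimizer\<close>

text \<open>The parallelogram law for \<open>x - y\<close> and \<open>x - z\<close>. The negative
  term is the strong convexity that makes minimizing sequences Cauchy.\<close>

lemma norm_diff_midpoint_sq:
  fixes x y z :: "'a::real_inner"
  shows "(norm (x - ((1/2) *\<^sub>R y + (1/2) *\<^sub>R z)))\<^sup>2
    = ((norm (x - y))\<^sup>2 + (norm (x - z))\<^sup>2) / 2 - (norm (y - z))\<^sup>2 / 4"
  unfolding power2_norm_eq_inner
  by (simp add: inner_diff_left inner_diff_right inner_add_left inner_add_right
      inner_commute[of y x] inner_commute[of z x] inner_commute[of z y]) argo

lemma norm_diff_scaleR_sq: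
  fixes v w :: "'a::real_inner"
  shows "(norm (v - t *\<^sub>R w))\<^sup>2 = (norm v)\<^sup>2 - 2 * t * (v \<bullet> w) + t\<^sup>2 * (norm w)\<^sup>2"
proof -
  have "(norm (v - t *\<^sub>R w))\<^sup>2 = v \<bullet> v - t * (v \<bullet> w) - (t * (v \<bullet> w) - t * (t * (w \<bullet> w)))"
    unfolding power2_norm_eq_inner
    by (simp add: inner_diff_left inner_diff_right inner_commute[of w v] right_diff_distrib)
  also have "\<dots> = (norm v)\<^sup>2 - 2 * t * (v \<bullet> w) + t\<^sup>2 * (norm w)\<^sup>2"
    unfolding power2_norm_eq_inner by algebra
  finally show ?thesis .
qed

text \<open>The quadratic term outgrows the linear loss permitted by the minorant of
  \<open>f\<close>.\<close>

lemma Gamma0_plus_sq_norm_bounded_below: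
  assumes f: "f \<in> Gamma0" and \<alpha>: "\<alpha> > 0"
  obtains c where "\<And>y. ereal c \<le> f y + ereal (\<alpha> * (norm (x - y))\<^sup>2)"
proof -
  obtain x0 a b where b: "b \<ge> 0" "\<And>y. ereal (a - b * norm (y - x0)) \<le> f y"
    using Gamma0_linear_growth_minorant[OF f] by blast
  \<comment> \<open>The middle term pays for moving the center from \<open>x0\<close> to
    \<open>x\<close>; the last is the minimum of \<open>\<alpha> * s\<^sup>2 - b * s\<close> over
    real \<open>s\<close>.\<close>
  define c where "c = a - b * norm (x - x0) - b\<^sup>2 / (4 * \<alpha>)"
  have "ereal c \<le> f y + ereal (\<alpha> * (norm (x - y))\<^sup>2)" for y
  proof -
    have "norm (y - x0) \<le> norm (x - y) + norm (x - x0)"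
      using norm_triangle_ineq4[of "x - x0" "x - y"] by simp
    then have 1: "b * norm (y - x0) \<le> b * norm (x - y) + b * norm (x - x0)"
      using mult_left_mono[OF _ b(1)] by (simp only: distrib_left[symmetric])
    have "0 \<le> \<alpha> * (norm (x - y) - b / (2 * \<alpha>))\<^sup>2"
      using \<alpha> by simp
    also have "\<dots> = \<alpha> * (norm (x - y))\<^sup>2 - b * norm (x - y) + b\<^sup>2 / (4 * \<alpha>)"
      using \<alpha> by (simp add: field_simps power2_eq_square)
    finally have "ereal c \<le> ereal (a - b * norm (y - x0)) + ereal (\<alpha> * (norm (x - y))\<^sup>2)"
      using 1 by (simp add: c_def)
    also have "\<dots> \<le> f y + ereal (\<alpha> * (norm (x - y))\<^sup>2)"
      by (intro add_right_mono b(2))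
    finally show ?thesis .
  qed
  then show thesis by (rule that)
qed

text \<open>A minimizing sequence is Cauchy by strong convexity, so completeness gives a norm limit,
  and lower semicontinuity makes this limit a minimizer.\<close>

lemma Gamma0_plus_sq_norm_attains_min:
  fixes f :: "'a::{real_inner, complete_space} \<Rightarrow> ereal"
  assumes f: "f \<in> Gamma0" and \<alpha>: "\<alpha> > 0"
  obtains p where "\<And>y. f p + ereal (\<alpha> * (norm (x - p))\<^sup>2) \<le> f y + ereal (\<alpha> * (norm (x - y))\<^sup>2)"
proof -
  define \<phi> where "\<phi> y = f y + ereal (\<alpha> * (norm (x - y))\<^sup>2)" for y
  have conv: "convex_function f" and lsc: "lower_semicontinuous f" and ninf: "\<And>y. f y \<noteq> -\<infinity>"
    using f by (auto simp: Gamma0_def proper_function_def)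
  obtain c where c: "\<And>y. ereal c \<le> \<phi> y"
    using Gamma0_plus_sq_norm_bounded_below[OF f \<alpha>] unfolding \<phi>_def by blast
  obtain x0 a where a: "f x0 = ereal a"
    using Gamma0_obtain_finite[OF f] .
  have "ereal c \<le> (INF y. \<phi> y)"
    using c by (auto intro: INF_greatest)
  moreover have "(INF y. \<phi> y) \<le> \<phi> x0"
    by (rule INF_lower) simp
  moreover have "\<phi> x0 < \<infinity>"
    by (simp add: \<phi>_def a)
  ultimately obtain m where m: "(INF y. \<phi> y) = ereal m"
    by (cases "INF y. \<phi> y") auto
  have m_le: "ereal m \<le> \<phi> y" for y
    unfolding m[symmetric] by (rule INF_lower) simp
  have "\<exists>y. \<phi> y < ereal (m + 1 / Suc n)" for n
  proof -
    have "(INF y. \<phi> y) < ereal (m + 1 / Suc n)"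
      by (simp add: m)
    then show ?thesis
      by (simp add: INF_less_iff)
  qed
  then obtain y where y: "\<And>n. \<phi> (y n) < ereal (m + 1 / Suc n)"
    by metis
  have "\<exists>r. f (y n) = ereal r" for n
    using y[of n] ninf[of "y n"] by (cases "f (y n)") (auto simp: \<phi>_def)
  then obtain F where F: "\<And>n. f (y n) = ereal (F n)"
    by metis
  have F_less: "F n + \<alpha> * (norm (x - y n))\<^sup>2 < m + 1 / Suc n" for n
    using y[of n] by (simp add: \<phi>_def F)
  \<comment> \<open>The midpoint of two almost minimal points cannot go below the infimum
    \<open>m\<close>, so the gain from the parallelogram law is at most the average of their
    errors.\<close>
  have gap: "\<alpha> / 4 * (norm (y j - y k))\<^sup>2 \<le> (1 / Suc j + 1 / Suc k) / 2" for j k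
  proof -
    define z where "z = (1/2) *\<^sub>R y j + (1/2) *\<^sub>R y k"
    have "f z \<le> ereal ((F j + F k) / 2)"
      using convex_functionD_ereal[OF conv F[of j] F[of k], of "1/2"]
      by (simp add: z_def field_simps)
    then have "ereal m \<le> ereal ((F j + F k) / 2) + ereal (\<alpha> * (norm (x - z))\<^sup>2)"
      using m_le[of z] unfolding \<phi>_def by (meson add_right_mono order_trans)
    then have "m \<le> (F j + F k) / 2 + \<alpha> * (norm (x - z))\<^sup>2"
      by simp
    moreover have "\<alpha> * (norm (x - z))\<^sup>2
        = (\<alpha> * (norm (x - y j))\<^sup>2 + \<alpha> * (norm (x - y k))\<^sup>2) / 2 - \<alpha> / 4 * (norm (y j - y k))\<^sup>2"
      unfolding z_def norm_diff_midpoint_sq by (simp add: algebra_simps add_divide_distrib)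
    ultimately show ?thesis
      using F_less[of j] F_less[of k] by argo
  qed
  have "Cauchy y"
  proof (rule metric_CauchyI)
    fix e :: real assume e: "e > 0"
    obtain N :: nat where N: "inverse (Suc N) < \<alpha> / 4 * e\<^sup>2"
      using reals_Archimedean[of "\<alpha> / 4 * e\<^sup>2"] e \<alpha> by auto
    have "dist (y j) (y k) < e" if "j \<ge> N" "k \<ge> N" for j k
    proof -
      have "1 / real (Suc j) \<le> inverse (Suc N)" "1 / real (Suc k) \<le> inverse (Suc N)"
        using that by (auto simp: field_simps)
      then have "\<alpha> / 4 * (norm (y j - y k))\<^sup>2 < \<alpha> / 4 * e\<^sup>2"
        using gap[of j k] N by simp
      then have "(norm (y j - y k))\<^sup>2 < e\<^sup>2"
        using \<alpha> by simp
      then show ?thesis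
        using e by (simp add: dist_norm power_less_imp_less_base)
    qed
    then show "\<exists>M. \<forall>j\<ge>M. \<forall>k\<ge>M. dist (y j) (y k) < e"
      by blast
  qed
  then obtain p where p: "y \<longlonglongrightarrow> p"
    using Cauchy_convergent convergent_def by blast
  \<comment> \<open>The norm term converges along \<open>y\<close>, so semicontinuity is only needed
    for \<open>f\<close>: a value \<open>r\<close> strictly between the two sides would stay below
    \<open>f (y n)\<close> eventually and contradict the limit of the upper bounds.\<close>
  have "f p \<le> ereal (m - \<alpha> * (norm (x - p))\<^sup>2)"
  proof (rule ccontr)
    assume "\<not> ?thesis"
    then obtain r where r: "m - \<alpha> * (norm (x - p))\<^sup>2 < r" "ereal r < f p"
      by (metis ereal_dense2 ereal_less_ereal_Ex less_ereal.simps(1) not_le)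
    have "\<forall>\<^sub>F n in sequentially. ereal r < f (y n)"
      by (rule eventually_compose_filterlim[OF lower_semicontinuous_eventually_nhds[OF lsc r(2)] p])
    then have "\<forall>\<^sub>F n in sequentially. r \<le> m + 1 / Suc n - \<alpha> * (norm (x - y n))\<^sup>2"
    proof (rule eventually_mono)
      fix n assume "ereal r < f (y n)"
      then show "r \<le> m + 1 / Suc n - \<alpha> * (norm (x - y n))\<^sup>2"
        using F_less[of n] by (simp add: F)
    qed
    moreover have "(\<lambda>n. m + 1 / Suc n - \<alpha> * (norm (x - y n))\<^sup>2)
        \<longlonglongrightarrow> m + 0 - \<alpha> * (norm (x - p))\<^sup>2"
      using p LIMSEQ_Suc[OF lim_1_over_n] by (intro tendsto_intros) auto
    ultimately have "r \<le> m + 0 - \<alpha> * (norm (x - p))\<^sup>2"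
      by (intro tendsto_lowerbound) auto
    with r(1) show False by simp
  qed
  then have "\<phi> p \<le> ereal (m - \<alpha> * (norm (x - p))\<^sup>2) + ereal (\<alpha> * (norm (x - p))\<^sup>2)"
    unfolding \<phi>_def by (rule add_right_mono)
  then have "\<phi> p \<le> \<phi> y" for y
    using m_le[of y] by (simp add: order_trans)
  then show thesis
    by (intro that[of p]) (simp add: \<phi>_def)
qed

section \<open>Optimality condition and the proximal point\<close>

text \<open>Compare \<open>p\<close> with a point a fraction \<open>t\<close> of the way to
  \<open>y\<close>, divide the inequality by \<open>t\<close> and let \<open>t\<close> tend to 0
  from the right: only the first-order part of the quadratic survives.\<close>

lemma arg_min_plus_sq_norm_subgradient:
  fixes f :: "'a::real_inner \<Rightarrow> ereal"
  assumes f: "f \<in> Gamma0"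
    and min: "\<And>y. f p + ereal (\<alpha> * (norm (x - p))\<^sup>2) \<le> f y + ereal (\<alpha> * (norm (x - y))\<^sup>2)"
  obtains a where "f p = ereal a" "\<And>y. ereal (a + 2 * \<alpha> * ((x - p) \<bullet> (y - p))) \<le> f y"
proof -
  have conv: "convex_function f" and ninf: "\<And>y. f y \<noteq> -\<infinity>"
    using f by (auto simp: Gamma0_def proper_function_def)
  obtain x0 b where "f x0 = ereal b"
    using Gamma0_obtain_finite[OF f] .
  then obtain a where a: "f p = ereal a"
    using min[of x0] ninf[of p] by (cases "f p") auto
  have "ereal (a + 2 * \<alpha> * ((x - p) \<bullet> (y - p))) \<le> f y" for y
  proof (cases "f y")
    case (real b)
    have "2 * \<alpha> * ((x - p) \<bullet> (y - p)) \<le> b - a + \<alpha> * t * (norm (y - p))\<^sup>2"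
      if t: "0 < t" "t < 1" for t
    proof -
      define z where "z = (1 - t) *\<^sub>R p + t *\<^sub>R y"
      have "f z \<le> ereal ((1 - t) * a + t * b)"
        unfolding z_def by (rule convex_functionD_ereal[OF conv a real t])
      then have "f z + ereal (\<alpha> * (norm (x - z))\<^sup>2)
          \<le> ereal ((1 - t) * a + t * b) + ereal (\<alpha> * (norm (x - z))\<^sup>2)"
        by (rule add_right_mono)
      from order_trans[OF min[of z] this]
      have 1: "a + \<alpha> * (norm (x - p))\<^sup>2 \<le> (1 - t) * a + t * b + \<alpha> * (norm (x - z))\<^sup>2"
        by (simp add: a)
      have "x - z = (x - p) - t *\<^sub>R (y - p)"
        by (simp add: z_def algebra_simps)
      then have 2: "(norm (x - z))\<^sup>2
          = (norm (x - p))\<^sup>2 - 2 * t * ((x - p) \<bullet> (y - p)) + t\<^sup>2 * (norm (y - p))\<^sup>2"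
        by (simp only: norm_diff_scaleR_sq)
      have "t * (b - a + \<alpha> * t * (norm (y - p))\<^sup>2) - t * (2 * \<alpha> * ((x - p) \<bullet> (y - p)))
          = ((1 - t) * a + t * b + \<alpha> * (norm (x - z))\<^sup>2) - (a + \<alpha> * (norm (x - p))\<^sup>2)"
        unfolding 2 by algebra
      with 1 have "t * (2 * \<alpha> * ((x - p) \<bullet> (y - p))) \<le> t * (b - a + \<alpha> * t * (norm (y - p))\<^sup>2)"
        by linarith
      then show ?thesis
        using t by simp
    qed
    then have "\<forall>\<^sub>F t in at_right 0.
        2 * \<alpha> * ((x - p) \<bullet> (y - p)) \<le> b - a + \<alpha> * t * (norm (y - p))\<^sup>2"
      by (auto simp: eventually_at_right_field intro!: exI[of _ 1])
    moreover have "((\<lambda>t. b - a + \<alpha> * t * (norm (y - p))\<^sup>2)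
        \<longlongrightarrow> b - a + \<alpha> * 0 * (norm (y - p))\<^sup>2) (at_right 0)"
      by (intro tendsto_intros)
    ultimately have "2 * \<alpha> * ((x - p) \<bullet> (y - p)) \<le> b - a + \<alpha> * 0 * (norm (y - p))\<^sup>2"
      by (intro tendsto_lowerbound) auto
    then show ?thesis
      by (simp add: real)
  qed (use ninf in auto)
  with a show thesis by (rule that)
qed

text \<open>Since \<open>prox\<close> is a definite description, both existence and uniqueness of
  the minimizer are required. The objective in \<open>prox\<close> is \<gamma> times the one in the
  envelope, so the minimizers agree.\<close>

lemma prox_Gamma0:
  fixes f :: "'a::{real_inner, complete_space} \<Rightarrow> ereal"
  assumes f: "f \<in> Gamma0" and \<gamma>: "\<gamma> > 0"
  shows "f (prox (\<lambda>y. ereal \<gamma> * f y) x) + ereal (1 / (2 * \<gamma>) * (norm (x - prox (\<lambda>y. ereal \<gamma> * f y) x))\<^sup>2)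
    \<le> f y + ereal (1 / (2 * \<gamma>) * (norm (x - y))\<^sup>2)"
proof -
  define \<phi> where "\<phi> y = f y + ereal (1 / (2 * \<gamma>) * (norm (x - y))\<^sup>2)" for y
  have scale: "ereal \<gamma> * f y + ereal (1 / 2 * (norm (x - y))\<^sup>2) = ereal \<gamma> * \<phi> y" for y
    using \<gamma> by (cases "f y") (auto simp: \<phi>_def field_simps)
  have arg_min: "is_arg_min (\<lambda>y. ereal \<gamma> * f y + ereal (1 / 2 * (norm (x - y))\<^sup>2)) (\<lambda>y. True) p
      \<longleftrightarrow> (\<forall>y. \<phi> p \<le> \<phi> y)" for p
    unfolding scale using \<gamma> by (simp add: is_arg_min_linorder ereal_mult_le_mult_iff)
  obtain p where p: "\<And>y. \<phi> p \<le> \<phi> y"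
    using Gamma0_plus_sq_norm_attains_min[OF f, of "1 / (2 * \<gamma>)" x] \<gamma> unfolding \<phi>_def by auto
  have unique: "q = p" if q: "\<forall>y. \<phi> q \<le> \<phi> y" for q
  proof -
    obtain a where a: "f p = ereal a"
      "\<And>y. ereal (a + 2 * (1 / (2 * \<gamma>)) * ((x - p) \<bullet> (y - p))) \<le> f y"
      using arg_min_plus_sq_norm_subgradient[OF f, of p "1 / (2 * \<gamma>)" x] p unfolding \<phi>_def by blast
    have "ereal (a + 2 * (1 / (2 * \<gamma>)) * ((x - p) \<bullet> (q - p))) + ereal (1 / (2 * \<gamma>) * (norm (x - q))\<^sup>2) \<le> \<phi> q"
      unfolding \<phi>_def by (intro add_right_mono a(2))
    also have "\<dots> \<le> \<phi> p"
      using q by simp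
    finally have "(1 / (2 * \<gamma>)) * (2 * ((x - p) \<bullet> (q - p)) + (norm (x - q))\<^sup>2)
        \<le> (1 / (2 * \<gamma>)) * (norm (x - p))\<^sup>2"
      by (simp add: \<phi>_def a(1) distrib_left)
    then have "2 * ((x - p) \<bullet> (q - p)) + (norm (x - q))\<^sup>2 \<le> (norm (x - p))\<^sup>2"
      using \<gamma> by (simp add: divide_le_cancel)
    \<comment> \<open>Expanding \<open>x - q = (x - p) - (q - p)\<close> turns the left side of the
      previous inequality into
      \<open>(norm (x - p))\<^sup>2 + (norm (q - p))\<^sup>2\<close>.\<close>
    then have "(norm (q - p))\<^sup>2 \<le> 0"
      by (simp add: power2_norm_eq_inner inner_simps inner_commute)
    then show ?thesis
      by simp
  qed
  have "prox (\<lambda>y. ereal \<gamma> * f y) x = p"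
    unfolding prox_def arg_min by (rule the_equality) (use p unique in blast)+
  then show ?thesis
    using p by (simp add: \<phi>_def)
qed

section \<open>Subdifferential of the envelope and the projector\<close>

lemma subdifferential_moreau_envelope:
  fixes f :: "'a::{real_inner, complete_space} \<Rightarrow> ereal"
  assumes f: "f \<in> Gamma0" and \<gamma>: "\<gamma> > 0"
  shows "subdifferential (moreau_envelope \<gamma> f) x = {(1 / \<gamma>) *\<^sub>R (x - prox (\<lambda>y. ereal \<gamma> * f y) x)}"
proof -
  define p where "p = prox (\<lambda>y. ereal \<gamma> * f y) x"
  have min: "f p + ereal (1 / (2 * \<gamma>) * (norm (x - p))\<^sup>2) \<le> f y + ereal (1 / (2 * \<gamma>) * (norm (x - y))\<^sup>2)" for y
    unfolding p_def by (rule prox_Gamma0[OF f \<gamma>])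
  obtain a where a: "f p = ereal a"
    "\<And>y. ereal (a + 2 * (1 / (2 * \<gamma>)) * ((x - p) \<bullet> (y - p))) \<le> f y"
    using arg_min_plus_sq_norm_subgradient[OF f min] by blast
  have env_x: "moreau_envelope \<gamma> f x = ereal (a + 1 / (2 * \<gamma>) * (norm (x - p))\<^sup>2)"
    unfolding moreau_envelope_def
    using min by (intro antisym INF_greatest INF_lower2[of p]) (auto simp: a(1))
  \<comment> \<open>The point \<open>p\<close> is optimal for \<open>x\<close> but competes in the
    infimum at every \<open>y\<close>.\<close>
  have env_le: "moreau_envelope \<gamma> f y \<le> ereal (a + 1 / (2 * \<gamma>) * (norm (y - p))\<^sup>2)" for y
    unfolding moreau_envelope_def by (rule INF_lower2[of p]) (auto simp: a(1))
  have "(1 / \<gamma>) *\<^sub>R (x - p) \<in> subdifferential (moreau_envelope \<gamma> f) x"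
    unfolding subdifferential_def
  proof (intro CollectI allI)
    fix y
    show "ereal ((y - x) \<bullet> (1 / \<gamma>) *\<^sub>R (x - p)) + moreau_envelope \<gamma> f x \<le> moreau_envelope \<gamma> f y"
      unfolding env_x moreau_envelope_def[of \<gamma> f y]
    proof (rule INF_greatest)
      fix z
      \<comment> \<open>The square to be dropped vanishes at \<open>z = y - (x - p)\<close>. What
        remains is bounded through the subgradient inequality of \<open>f\<close> at
        \<open>p\<close>, tested at the competitor \<open>z\<close>.\<close>
      have "2 * ((y - x) \<bullet> (x - p)) + (norm (x - p))\<^sup>2 + (norm ((x - p) - (y - z)))\<^sup>2
          = 2 * ((x - p) \<bullet> (z - p)) + (norm (y - z))\<^sup>2"
        by (simp add: power2_norm_eq_inner inner_simps inner_commute)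
      then have "2 * ((y - x) \<bullet> (x - p)) + (norm (x - p))\<^sup>2
          \<le> 2 * ((x - p) \<bullet> (z - p)) + (norm (y - z))\<^sup>2"
        by (smt (verit) zero_le_power2)
      then have "(1 / (2 * \<gamma>)) * (2 * ((y - x) \<bullet> (x - p)) + (norm (x - p))\<^sup>2)
          \<le> (1 / (2 * \<gamma>)) * (2 * ((x - p) \<bullet> (z - p)) + (norm (y - z))\<^sup>2)"
        using \<gamma> by (intro mult_left_mono) auto
      then have "ereal ((y - x) \<bullet> (1 / \<gamma>) *\<^sub>R (x - p)) + ereal (a + 1 / (2 * \<gamma>) * (norm (x - p))\<^sup>2)
          \<le> ereal (a + 2 * (1 / (2 * \<gamma>)) * ((x - p) \<bullet> (z - p))) + ereal (1 / (2 * \<gamma>) * (norm (y - z))\<^sup>2)"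
        by (simp add: distrib_left)
      also have "\<dots> \<le> f z + ereal (1 / (2 * \<gamma>) * (norm (y - z))\<^sup>2)"
        by (intro add_right_mono a(2))
      finally show "ereal ((y - x) \<bullet> (1 / \<gamma>) *\<^sub>R (x - p)) + ereal (a + 1 / (2 * \<gamma>) * (norm (x - p))\<^sup>2)
          \<le> f z + ereal (1 / (2 * \<gamma>) * (norm (y - z))\<^sup>2)" .
    qed
  qed
  moreover have "u = (1 / \<gamma>) *\<^sub>R (x - p)" if u: "u \<in> subdifferential (moreau_envelope \<gamma> f) x" for u
  proof -
    define v where "v = u - (1 / \<gamma>) *\<^sub>R (x - p)"
    \<comment> \<open>The step \<open>\<gamma>\<close> is the minimiser of \<open>t \<mapsto> t\<^sup>2 \<parallel>v\<parallel>\<^sup>2 / (2\<gamma>) - t \<parallel>v\<parallel>\<^sup>2\<close>.\<close>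
    define y where "y = x + \<gamma> *\<^sub>R v"
    have "ereal ((y - x) \<bullet> u) + moreau_envelope \<gamma> f x \<le> moreau_envelope \<gamma> f y"
      using u by (simp add: subdifferential_def)
    also note env_le[of y]
    finally have 1: "(y - x) \<bullet> u + 1 / (2 * \<gamma>) * (norm (x - p))\<^sup>2 \<le> 1 / (2 * \<gamma>) * (norm (y - p))\<^sup>2"
      by (simp add: env_x)
    have "y - p = (x - p) - (- \<gamma>) *\<^sub>R v"
      by (simp add: y_def)
    then have "(norm (y - p))\<^sup>2 = (norm (x - p))\<^sup>2 + 2 * \<gamma> * (v \<bullet> (x - p)) + \<gamma>\<^sup>2 * (norm v)\<^sup>2"
      by (simp only: norm_diff_scaleR_sq) (simp add: inner_commute)
    then have "1 / (2 * \<gamma>) * (norm (y - p))\<^sup>2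
        = 1 / (2 * \<gamma>) * (norm (x - p))\<^sup>2 + v \<bullet> (x - p) + \<gamma> / 2 * (norm v)\<^sup>2"
      using \<gamma> by (simp add: field_simps power2_eq_square)
    moreover have "(y - x) \<bullet> u = \<gamma> * (norm v)\<^sup>2 + v \<bullet> (x - p)"
    proof -
      have "u = v + (1 / \<gamma>) *\<^sub>R (x - p)"
        by (simp add: v_def)
      then have "(y - x) \<bullet> u = \<gamma> * (v \<bullet> (v + (1 / \<gamma>) *\<^sub>R (x - p)))"
        by (simp add: y_def)
      then show ?thesis
        using \<gamma> by (simp add: power2_norm_eq_inner inner_add_right distrib_left)
    qed
    \<comment> \<open>The terms \<open>v \<bullet> (x - p)\<close> cancel; the subgradient forces
      growth \<open>\<gamma> * (norm v)\<^sup>2\<close>, while the parabola allows only half of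
      it.\<close>
    ultimately have "\<gamma> * (norm v)\<^sup>2 \<le> 0"
      using 1 by simp
    then have "v = 0"
      using \<gamma> by (simp add: mult_le_0_iff)
    then show ?thesis
      by (simp add: v_def)
  qed
  ultimately show ?thesis
    unfolding p_def by blast
qed

theorem proposition2p26:
  fixes f :: "'a::{real_inner, complete_space} \<Rightarrow> ereal"
    and \<gamma> :: real
  assumes "f \<in> Gamma0"
    and "\<gamma> > 0"
    and "{x. moreau_envelope \<gamma> f x \<le> 0} \<noteq> {}"
  shows "set_valued_dom (subgradient_projector (moreau_envelope \<gamma> f)) = UNIV \<and>
    (\<forall>x. is_singleton (subgradient_projector (moreau_envelope \<gamma> f) x)) \<and>
    (\<forall>x. subgradient_projector (moreau_envelope \<gamma> f) x =
      {if moreau_envelope \<gamma> f x \<le> 0 then x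
       else x - (\<gamma> * (real_of_ereal (moreau_envelope \<gamma> f x)
                  / (norm (x - prox (\<lambda>y. ereal \<gamma> * f y) x))\<^sup>2))
                *\<^sub>R (x - prox (\<lambda>y. ereal \<gamma> * f y) x)})"
proof -
  \<comment> \<open>For the only subgradient \<open>(1 / \<gamma>) *\<^sub>R w\<close>, the squared
    norm contributes \<gamma> squared and the vector takes one factor back. At \<open>w = 0\<close>
    both sides are 0, as division by zero yields 0.\<close>
  have coeff: "r / (norm ((1 / \<gamma>) *\<^sub>R w))\<^sup>2 * (1 / \<gamma>) = \<gamma> * (r / (norm w)\<^sup>2)" for r and w :: 'a
    using \<open>\<gamma> > 0\<close> by (simp add: power_divide power2_eq_square)
  have "subgradient_projector (moreau_envelope \<gamma> f) x =
      {if moreau_envelope \<gamma> f x \<le> 0 then x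
       else x - (\<gamma> * (real_of_ereal (moreau_envelope \<gamma> f x)
                  / (norm (x - prox (\<lambda>y. ereal \<gamma> * f y) x))\<^sup>2))
                *\<^sub>R (x - prox (\<lambda>y. ereal \<gamma> * f y) x)}" for x
    unfolding subgradient_projector_def subdifferential_moreau_envelope[OF assms(1,2)]
      coeff[symmetric] by simp
  \<comment> \<open>An explicit singleton at every \<open>x\<close> yields the full domain and
    single-valuedness at once.\<close>
  then show ?thesis
    by (simp add: set_valued_dom_def)
qed

end
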